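(* For a Tychonoff space $X$, the following assertions (a) and (b) are equivalent: (a) $X$ is an $s_{\mathbb{R}}$-space; (b) there is a cover $\mathcal{M}$ of $X$ consisting of subspaces of $X$ which are $s_{\mathbb{R}}$-spaces and having (at least) one of the following properties: (i) for every subset $A$ of $X$ and each point $x\in\overline{A}$, there is $B\in\mathcal{M}$ such that $x\in B\cap\overline{A\cap B}$; (ii) for every non-closed subset $Q$ of $X$, there are a point $x\in\overline{Q}\setminus Q$ and an $M\in\mathcal{M}$ such that $x\in M\cap\overline{Q\cap M}$; (iii) $M$ is sequentially dense in $X$ for each $M\in\mathcal{M}$; (iv) $M$ is $s_{\mathbb{R}}$-dense in $X$ for each $M\in\mathcal{M}$; (v) $\mathcal{M}$ is locally finite and all $M\in\mathcal{M}$ are closed; (vi) $M\cap L$ is dense in $X$ for all $M,L\in\mathcal{M}$.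
   Context: All spaces are assumed to be Tychonoff. A function $f:X\to\mathbb{R}$ is $s$-continuous if its restriction to each convergent sequence in $X$ (together with its limit) is continuous. A space $X$ is an $s_{\mathbb{R}}$-space if every $s$-continuous function $f:X\to\mathbb{R}$ is continuous. A subset $Y\subseteq X$ is sequentially dense if each point $x\in X$ is the limit of a sequence of points of $Y$. A subset $L\subseteq X$ is $s_{\mathbb{R}}$-dense in $X$ if for every $x\in X$ there is a subspace $N\subseteq X$ which is an $s_{\mathbb{R}}$-space and satisfies $x\in N\cap\overline{N\cap L}$. Closures are taken in $X$. *)

theory Defs
  imports "HOL-Analysis.Analysis"
begin

definition tychonoff_space :: "'a topology \<Rightarrow> bool" where
  "tychonoff_space X \<longleftrightarrow> completely_regular_space X \<and> Hausdorff_space X"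

text \<open>
  A convergent sequence together with its limit is the subspace \<open>insert x (range s)\<close>.
  Here \<open>limitin\<close> constrains the sequence only eventually, so that \<open>s\<close> lies in the space
  is required separately.
\<close>

definition s_continuous :: "'a topology \<Rightarrow> ('a \<Rightarrow> real) \<Rightarrow> bool" where
  "s_continuous X f \<longleftrightarrow>
     (\<forall>s :: nat \<Rightarrow> 'a. \<forall>x. range s \<subseteq> topspace X \<and> limitin X s x sequentially \<longrightarrow>
        continuous_map (subtopology X (insert x (range s))) euclideanreal f)"

definition sR_space :: "'a topology \<Rightarrow> bool" where
  "sR_space X \<longleftrightarrow>
     (\<forall>f :: 'a \<Rightarrow> real. s_continuous X f \<longrightarrow> continuous_map X euclideanreal f)"

definition sR_subspace :: "'a topology \<Rightarrow> 'a set \<Rightarrow> bool" where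
  "sR_subspace X N \<longleftrightarrow> N \<subseteq> topspace X \<and> sR_space (subtopology X N)"

definition sequentially_dense_in :: "'a topology \<Rightarrow> 'a set \<Rightarrow> bool" where
  "sequentially_dense_in X Y \<longleftrightarrow>
     Y \<subseteq> topspace X \<and>
     (\<forall>x \<in> topspace X. \<exists>s :: nat \<Rightarrow> 'a. range s \<subseteq> Y \<and> limitin X s x sequentially)"

definition sR_dense_in :: "'a topology \<Rightarrow> 'a set \<Rightarrow> bool" where
  "sR_dense_in X L \<longleftrightarrow>
     L \<subseteq> topspace X \<and>
     (\<forall>x \<in> topspace X. \<exists>N. sR_subspace X N \<and> x \<in> N \<inter> (X closure_of (N \<inter> L)))"

end

theory Submission
  imports Defs
begin

text \<open>
  An s-continuous function is continuous on every subspace which is an \<open>s\<^sub>R\<close>-space, so the question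
  is when continuity can be checked on the members of \<open>\<M>\<close>. Both (i) and (v) imply (ii), under
  which preimages of closed sets are closed. Both (iii) and (vi) imply (iv): a convergent sequence
  with its limit is an \<open>s\<^sub>R\<close>-space, and in (vi) the members of \<open>\<M>\<close> themselves serve as witnesses.
  Under (iv), if f varies by less than \<open>\<epsilon>\<close> on \<open>U \<inter> M\<close>, then any \<open>z \<in> U\<close> has a point \<open>w \<in> U \<inter> M\<close> with
  \<open>f w\<close> close to \<open>f z\<close>, found inside the witness for z; hence f varies by less than \<open>2\<epsilon>\<close> on \<open>U\<close>.
\<close>

text \<open>Convergence in the subspace implies convergence in \<open>X\<close>, and both spaces
  induce the same topology on a sequence with its limit, so every test subspace for the subspace is
  already one for \<open>X\<close>.\<close>

lemma s_continuous_subtopology: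
  assumes "s_continuous X f"
  shows "s_continuous (subtopology X M) f"
  unfolding s_continuous_def
proof (intro allI impI, elim conjE)
  fix s :: "nat \<Rightarrow> 'a" and x
  assume s: "range s \<subseteq> topspace (subtopology X M)"
    and lim: "limitin (subtopology X M) s x sequentially"
  have x: "x \<in> M" "limitin X s x sequentially"
    using lim by (auto simp: limitin_subtopology)
  then have "continuous_map (subtopology X (insert x (range s))) euclideanreal f"
    using assms s by (auto simp: s_continuous_def)
  moreover have "M \<inter> insert x (range s) = insert x (range s)"
    using s x(1) by auto
  ultimately show "continuous_map (subtopology (subtopology X M) (insert x (range s))) euclideanreal f"
    by (simp add: subtopology_subtopology)
qed

lemma s_continuous_on_sR_subspace:
  assumes "s_continuous X f" "sR_subspace X M"
  shows "continuous_map (subtopology X M) euclideanreal f"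
  using assms s_continuous_subtopology unfolding sR_subspace_def sR_space_def by blast

text \<open>The sequence with its limit is one of its own test subspaces, so for a function on it
  s-continuity already is continuity.\<close>

lemma sR_subspace_convergent_sequence:
  assumes "range s \<subseteq> topspace X" "limitin X s x sequentially"
  shows "sR_subspace X (insert x (range s))"
proof -
  let ?S = "insert x (range s)"
  have "?S \<subseteq> topspace X"
    using assms limitin_topspace by fastforce
  moreover have "continuous_map (subtopology X ?S) euclideanreal f"
    if "s_continuous (subtopology X ?S) f" for f
  proof -
    have "limitin (subtopology X ?S) s x sequentially"
      using assms by (simp add: limitin_subtopology)
    moreover have "range s \<subseteq> topspace (subtopology X ?S)"
      using assms by auto
    ultimately have "continuous_map (subtopology (subtopology X ?S) ?S) euclideanreal f"
      using that unfolding s_continuous_def by blast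
    then show ?thesis
      by (simp add: subtopology_subtopology)
  qed
  ultimately show ?thesis
    by (simp add: sR_subspace_def sR_space_def)
qed

lemma continuous_map_real_iff:
  "continuous_map X euclideanreal f \<longleftrightarrow>
    (\<forall>x \<in> topspace X. \<forall>e>0. \<exists>U. openin X U \<and> x \<in> U \<and> (\<forall>y\<in>U. \<bar>f y - f x\<bar> < e))"
  using Met_TC.continuous_map_to_metric[of X f]
  unfolding mtopology_is_euclidean mball_eq_ball mem_ball dist_real_def
  by (simp only: abs_minus_commute)

text \<open>The neighbourhood is taken open in \<open>X\<close> rather than in the subspace, so that
  neighbourhoods obtained from two different subspaces can be intersected.\<close>

lemma continuous_map_subtopology_realD:
  assumes "continuous_map (subtopology X M) euclideanreal f" "x \<in> topspace X" "x \<in> M" "e > 0"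
  obtains U where "openin X U" "x \<in> U" "\<And>y. y \<in> U \<inter> M \<Longrightarrow> \<bar>f y - f x\<bar> < e"
proof -
  obtain V where "openin (subtopology X M) V" "x \<in> V" "\<forall>y\<in>V. \<bar>f y - f x\<bar> < e"
    using assms unfolding continuous_map_real_iff topspace_subtopology by (meson IntI)
  moreover from this obtain U where "openin X U" "V = U \<inter> M"
    by (auto simp: openin_subtopology)
  ultimately show thesis
    using that[of U] by simp
qed

lemma sR_dense_in_if_sequentially_dense_in:
  assumes "sequentially_dense_in X M"
  shows "sR_dense_in X M"
  unfolding sR_dense_in_def
proof (intro conjI ballI)
  show M: "M \<subseteq> topspace X"
    using assms by (simp add: sequentially_dense_in_def)
  fix x
  assume "x \<in> topspace X"
  then obtain s :: "nat \<Rightarrow> 'a" where s: "range s \<subseteq> M" "limitin X s x sequentially"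
    using assms by (auto simp: sequentially_dense_in_def)
  \<comment> \<open>The point \<open>x\<close> may lie outside \<open>M\<close>; inserting it puts
    it into the witness, while the terms of \<open>s\<close> remain in \<open>?S \<inter> M\<close>
    and accumulate at \<open>x\<close>.\<close>
  let ?S = "insert x (range s)"
  have "x \<in> X closure_of (?S \<inter> M)"
    unfolding in_closure_of
  proof (intro conjI allI impI)
    show "x \<in> topspace X" by fact
    fix T
    assume "x \<in> T \<and> openin X T"
    then have "\<exists>n. s n \<in> T"
      using s(2) by (auto simp: limitin_sequentially)
    then show "\<exists>y. y \<in> ?S \<inter> M \<and> y \<in> T"
      using s(1) by auto
  qed
  moreover have "sR_subspace X ?S"
    using s M by (intro sR_subspace_convergent_sequence) auto
  ultimately show "\<exists>N. sR_subspace X N \<and> x \<in> N \<inter> X closure_of (N \<inter> M)"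
    by blast
qed

lemma sR_space_if_sR_dense_cover:
  assumes cover: "\<Union>\<M> = topspace X"
    and sR: "\<And>M. M \<in> \<M> \<Longrightarrow> sR_subspace X M"
    and dense: "\<And>M. M \<in> \<M> \<Longrightarrow> sR_dense_in X M"
  shows "sR_space X"
  unfolding sR_space_def continuous_map_real_iff
proof (intro allI impI ballI)
  fix f :: "'a \<Rightarrow> real" and x and e :: real
  assume f: "s_continuous X f" and x: "x \<in> topspace X" and e: "e > 0"
  obtain M where M: "M \<in> \<M>" "x \<in> M"
    using cover x by auto
  obtain U where U: "openin X U" "x \<in> U" "\<And>y. y \<in> U \<inter> M \<Longrightarrow> \<bar>f y - f x\<bar> < e/2"
    using continuous_map_subtopology_realD[OF s_continuous_on_sR_subspace[OF f sR[OF M(1)]] x M(2)] e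
    by (metis half_gt_zero)
  \<comment> \<open>So far \<open>U\<close> controls \<open>f\<close> only on \<open>M\<close>. The
    same \<open>U\<close> serves for all its points at the cost of doubling the bound.\<close>
  have "\<bar>f z - f x\<bar> < e" if z: "z \<in> U" for z
  proof -
    have zX: "z \<in> topspace X"
      using U(1) z openin_subset by blast
    then obtain N where N: "sR_subspace X N" "z \<in> N" "z \<in> X closure_of (N \<inter> M)"
      using dense[OF M(1)] by (auto simp: sR_dense_in_def)
    obtain V where V: "openin X V" "z \<in> V" "\<And>y. y \<in> V \<inter> N \<Longrightarrow> \<bar>f y - f z\<bar> < e/2"
      using continuous_map_subtopology_realD[OF s_continuous_on_sR_subspace[OF f N(1)] zX N(2)] e
      by (metis half_gt_zero)
    \<comment> \<open>\<open>U \<inter> V\<close> is a neighbourhood of \<open>z\<close>, hence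
      meets \<open>N \<inter> M\<close>. The point \<open>w\<close> is compared with
      \<open>x\<close> inside \<open>M\<close> and with \<open>z\<close> inside
      \<open>N\<close>.\<close>
    obtain w where "w \<in> N \<inter> M" "w \<in> U \<inter> V"
      using N(3) U(1) V(1,2) z unfolding in_closure_of by (meson IntI openin_Int)
    then have "\<bar>f w - f x\<bar> < e/2" "\<bar>f w - f z\<bar> < e/2"
      using U(3) V(3) by auto
    then show ?thesis
      by linarith
  qed
  then show "\<exists>U. openin X U \<and> x \<in> U \<and> (\<forall>y\<in>U. \<bar>f y - f x\<bar> < e)"
    using U by blast
qed

text \<open>Since \<open>f\<close> is continuous on each \<open>M\<close>, the preimage of a closed
  set has a relatively closed trace on \<open>M\<close>. A detected point lies in \<open>M\<close>
  and in the closure of that trace, hence in the preimage, contrary to its choice.\<close>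

lemma sR_space_if_cover_detects_closed:
  assumes sR: "\<And>M. M \<in> \<M> \<Longrightarrow> sR_subspace X M"
    and detect: "\<And>Q. \<lbrakk>Q \<subseteq> topspace X; \<not> closedin X Q\<rbrakk> \<Longrightarrow>
      \<exists>x \<in> X closure_of Q - Q. \<exists>M \<in> \<M>. x \<in> M \<inter> (X closure_of (Q \<inter> M))"
  shows "sR_space X"
  unfolding sR_space_def continuous_map_closedin
proof (intro allI impI conjI)
  fix f :: "'a \<Rightarrow> real" and C
  assume f: "s_continuous X f" and C: "closedin euclideanreal C"
  let ?Q = "{x \<in> topspace X. f x \<in> C}"
  show "closedin X ?Q"
  proof (rule ccontr)
    assume "\<not> closedin X ?Q"
    then obtain x M where xM: "x \<in> X closure_of ?Q - ?Q" "M \<in> \<M>" "x \<in> M"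
        "x \<in> X closure_of (?Q \<inter> M)"
      using detect[of ?Q] by auto
    have "closedin (subtopology X M) {y \<in> topspace (subtopology X M). f y \<in> C}"
      using s_continuous_on_sR_subspace[OF f sR[OF xM(2)]] C
      by (simp add: continuous_map_closedin)
    then obtain D where D: "closedin X D" "{y \<in> topspace (subtopology X M). f y \<in> C} = D \<inter> M"
      by (auto simp: closedin_subtopology)
    then have "?Q \<inter> M \<subseteq> D"
      by auto
    then have "x \<in> D"
      using closure_of_minimal D(1) xM(4) by blast
    then show False
      using xM(1,3) D(2) by (auto simp: in_closure_of)
  qed
qed auto

theorem theorem7p3:
  fixes X :: "'a topology"
  assumes "tychonoff_space X"
  shows "sR_space X \<longleftrightarrow>
    (\<exists>\<M> :: 'a set set. \<Union>\<M> = topspace X \<and> (\<forall>M \<in> \<M>. sR_subspace X M) \<and>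
      ((\<forall>A x. A \<subseteq> topspace X \<and> x \<in> X closure_of A \<longrightarrow>
           (\<exists>B \<in> \<M>. x \<in> B \<inter> (X closure_of (A \<inter> B)))) \<or>
       (\<forall>Q. Q \<subseteq> topspace X \<and> \<not> closedin X Q \<longrightarrow>
           (\<exists>x \<in> X closure_of Q - Q. \<exists>M \<in> \<M>. x \<in> M \<inter> (X closure_of (Q \<inter> M)))) \<or>
       (\<forall>M \<in> \<M>. sequentially_dense_in X M) \<or>
       (\<forall>M \<in> \<M>. sR_dense_in X M) \<or>
       (locally_finite_in X \<M> \<and> (\<forall>M \<in> \<M>. closedin X M)) \<or>
       (\<forall>M \<in> \<M>. \<forall>L \<in> \<M>. X closure_of (M \<inter> L) = topspace X)))"
  (is "_ \<longleftrightarrow> ?b")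
proof
  assume "sR_space X"
  then have "sR_subspace X (topspace X)"
    by (simp add: sR_subspace_def)
  \<comment> \<open>This is (i) for the cover whose only member is the whole space.\<close>
  moreover have "x \<in> topspace X \<inter> X closure_of (A \<inter> topspace X)"
    if "A \<subseteq> topspace X" "x \<in> X closure_of A" for A x
    using that by (simp add: Int_absorb2 in_closure_of)
  ultimately show ?b
    by (intro exI[of _ "{topspace X}"]) simp
next
  assume ?b
  then obtain \<M> where cover: "\<Union>\<M> = topspace X"
    and sR: "\<And>M. M \<in> \<M> \<Longrightarrow> sR_subspace X M"
    and cases: "(\<forall>A x. A \<subseteq> topspace X \<and> x \<in> X closure_of A \<longrightarrow>
           (\<exists>B \<in> \<M>. x \<in> B \<inter> (X closure_of (A \<inter> B)))) \<or>
       (\<forall>Q. Q \<subseteq> topspace X \<and> \<not> closedin X Q \<longrightarrow>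
           (\<exists>x \<in> X closure_of Q - Q. \<exists>M \<in> \<M>. x \<in> M \<inter> (X closure_of (Q \<inter> M)))) \<or>
       (\<forall>M \<in> \<M>. sequentially_dense_in X M) \<or>
       (\<forall>M \<in> \<M>. sR_dense_in X M) \<or>
       (locally_finite_in X \<M> \<and> (\<forall>M \<in> \<M>. closedin X M)) \<or>
       (\<forall>M \<in> \<M>. \<forall>L \<in> \<M>. X closure_of (M \<inter> L) = topspace X)"
    by (elim exE conjE) (rule that; simp only:)
  have detects: "sR_space X"
    if "\<And>Q. \<lbrakk>Q \<subseteq> topspace X; \<not> closedin X Q\<rbrakk> \<Longrightarrow>
      \<exists>x \<in> X closure_of Q - Q. \<exists>M \<in> \<M>. x \<in> M \<inter> (X closure_of (Q \<inter> M))"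
    using sR_space_if_cover_detects_closed[OF sR that] .
  have dense: "sR_space X" if "\<And>M. M \<in> \<M> \<Longrightarrow> sR_dense_in X M"
    using sR_space_if_sR_dense_cover[OF cover sR that] .
  from cases show "sR_space X"
  proof (elim disjE)
    assume i: "\<forall>A x. A \<subseteq> topspace X \<and> x \<in> X closure_of A \<longrightarrow>
      (\<exists>B \<in> \<M>. x \<in> B \<inter> (X closure_of (A \<inter> B)))"
    show ?thesis
    proof (rule detects)
      fix Q
      assume Q: "Q \<subseteq> topspace X" "\<not> closedin X Q"
      \<comment> \<open>Under (i) any closure point outside \<open>Q\<close> will do: apply (i) with
        \<open>A\<close> taken to be \<open>Q\<close>.\<close>
      then obtain x where "x \<in> X closure_of Q - Q"
        using closure_of_subset_eq by blast
      then show "\<exists>x \<in> X closure_of Q - Q. \<exists>M \<in> \<M>. x \<in> M \<inter> (X closure_of (Q \<inter> M))"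
        using i Q(1) by blast
    qed
  next
    assume v: "locally_finite_in X \<M> \<and> (\<forall>M \<in> \<M>. closedin X M)"
    show ?thesis
    proof (rule detects, rule ccontr)
      fix Q
      assume Q: "Q \<subseteq> topspace X" "\<not> closedin X Q"
      assume no: "\<not> (\<exists>x \<in> X closure_of Q - Q. \<exists>M \<in> \<M>. x \<in> M \<inter> (X closure_of (Q \<inter> M)))"
      \<comment> \<open>A closure point of \<open>Q \<inter> M\<close> stays in the closed set
        \<open>M\<close>; if it were outside \<open>Q\<close>, it would be the point denied by
        \<open>no\<close>.\<close>
      have "closedin X (Q \<inter> M)" if M: "M \<in> \<M>" for M
      proof -
        have "X closure_of (Q \<inter> M) \<subseteq> M"
          using v M by (intro closure_of_minimal) auto
        moreover have "X closure_of (Q \<inter> M) \<subseteq> X closure_of Q"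
          by (intro closure_of_mono) auto
        ultimately have "X closure_of (Q \<inter> M) \<subseteq> Q \<inter> M"
          using no M by blast
        then show ?thesis
          using Q(1) closure_of_subset_eq[of "Q \<inter> M" X] by blast
      qed
      \<comment> \<open>Each trace is contained in its member, so local finiteness is inherited.
        Then the union of the closed traces, which is \<open>Q\<close> because the members cover the
        space, is closed.\<close>
      moreover have "locally_finite_in X ((\<inter>) Q ` \<M>)"
        using v by (intro locally_finite_in_refinement) auto
      ultimately have "closedin X (\<Union> ((\<inter>) Q ` \<M>))"
        by (intro closedin_locally_finite_Union) auto
      moreover have "\<Union> ((\<inter>) Q ` \<M>) = Q"
        using cover Q(1) by blast
      ultimately show False
        using Q(2) by simp
    qed
  next
    assume vi: "\<forall>M \<in> \<M>. \<forall>L \<in> \<M>. X closure_of (M \<inter> L) = topspace X"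
    show ?thesis
    proof (rule dense)
      fix M
      assume M: "M \<in> \<M>"
      have "\<exists>N. sR_subspace X N \<and> x \<in> N \<inter> X closure_of (N \<inter> M)" if x: "x \<in> topspace X" for x
      proof -
        \<comment> \<open>A member \<open>L\<close> through \<open>x\<close> is the witness: the
          closure of \<open>L \<inter> M\<close> is the whole space, so it contains
          \<open>x\<close>.\<close>
        obtain L where "L \<in> \<M>" "x \<in> L"
          using cover x by auto
        then show ?thesis
          using vi M sR x by blast
      qed
      then show "sR_dense_in X M"
        using cover M by (auto simp: sR_dense_in_def)
    qed
    next
    assume ii: "\<forall>Q. Q \<subseteq> topspace X \<and> \<not> closedin X Q \<longrightarrow>
      (\<exists>x \<in> X closure_of Q - Q. \<exists>M \<in> \<M>. x \<in> M \<inter> (X closure_of (Q \<inter> M)))"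
    show ?thesis
      by (rule detects) (use ii in \<open>simp only: simp_thms\<close>)
  next
    assume "\<forall>M \<in> \<M>. sequentially_dense_in X M"
    then show ?thesis
      by (intro dense sR_dense_in_if_sequentially_dense_in) simp
  next
    assume "\<forall>M \<in> \<M>. sR_dense_in X M"
    then show ?thesis
      by (intro dense) simp
  qed
qed

end
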